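(* Let $H$ be a finite Boolean algebra and let $f:M\to N$ be a morphism in $Heymod_H$. Then $Coim(f)=Im(f)$ as submodules of $N$, where $Coim(f)$ is identified with the submodule $I_f=\{f(m) : m\in M\}$ of $N$.
   Context: Lattices have all finite meets and joins (hence a least element $0$ and a greatest element $1$). A join semilattice is a poset in which every finite subset, including the empty one, has a join; its least element is $0$. For a distributive lattice $L$, a distributive module over $L$ is a join semilattice $M$ with an action $L\times M\to M$, $(x,m)\mapsto x\wedge m$, order preserving in both variables, such that $1\wedge m=m$, $0\wedge m=0$, $(x\wedge y)\wedge m=x\wedge(y\wedge m)$, $(x\vee y)\wedge m=(x\wedge m)\vee(y\wedge m)$, $x\wedge(m\vee n)=(x\wedge m)\vee(x\wedge n)$. Morphisms are maps preserving finite joins (including $0$) and satisfying $g(x\wedge m)=x\wedge g(m)$. A Heyting algebra $H$ is a lattice such that for all $y,z\in H$ there is $(y\to z)_H\in H$ with $x\wedge y\le z\Leftrightarrow x\le (y\to z)_H$ for all $x\in H$ (every Boolean algebra is one). A Heyting module over $H$ is a distributive module $M$ over $H$ such that for all $m,n\in M$ there is $(m\to n)_M\in H$ with $x\wedge m\le n\Leftrightarrow x\le(m\to n)_M$ for all $x\in H$; morphisms are morphisms of distributive modules. $Heymod_H$ is the resulting category; for $H$ finite it has equalizers (computed on underlying sets), coequalizers, and finite products which are also coproducts, with $M\times N$ computed componentwise. For $f:M\to N$ in $Heymod_H$, with projections $p_1,p_2:M^2\to M$ and inclusions $e_1,e_2:N\to N^2$, $e_1(n)=(n,0)$, $e_2(n)=(0,n)$: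 the kernel pair $Ker_p(f)\subseteq M^2$ is the equalizer of $f\circ p_1,f\circ p_2:M^2\to N$; the coimage $Coim(f)$ is the coequalizer of the two composites $Ker_p(f)\hookrightarrow M^2\to M$ with $p_1$ and $p_2$. The cokernel pair $Coker_p(f)$ is the coequalizer of $e_1\circ f,e_2\circ f:M\to N^2$; the image $Im(f)\subseteq N$ is the equalizer of the two composites of $e_1,e_2:N\to N^2$ with $N^2\to Coker_p(f)$. The coimage $Coim(f)$ is the quotient of $M$ by the relation $m\sim m'\Leftrightarrow f(m)=f(m')$, and $f$ induces an isomorphism of it with $I_f$. *)

theory Defs
  imports Main "HOL-Algebra.Lattice"
begin

(* A join semilattice with least element is a poset in which all finite subsets have joins. *)
locale join_semilattice = upper_semilattice L + weak_partial_order_bottom L for L (structure)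

lemma (in join_semilattice) finite_join_exists:
  assumes "finite A" "A \<subseteq> carrier L"
  shows "\<exists>s. least L s (Upper L A)"
proof (cases "A = {}")
  case True
  then show ?thesis using bottom_exists by (simp add: Upper_def)
next
  case False
  then show ?thesis using finite_sup_least[OF assms] by blast
qed

record ('h, 'm) hmod = "'m gorder" +
  act :: "'h \<Rightarrow> 'm \<Rightarrow> 'm" (infixr "\<triangleright>\<index>" 75)

(* HOL-Algebra's Order.top shadows the top element of a type class; hence the qualified names. *)
locale distributive_module = join_semilattice M
  for M :: "('h :: {distrib_lattice, bounded_lattice}, 'm) hmod" (structure) +
  assumes act_closed [simp]: "m \<in> carrier M \<Longrightarrow> x \<triangleright> m \<in> carrier M"
    and act_mono_left: "\<lbrakk>x \<le> y; m \<in> carrier M\<rbrakk> \<Longrightarrow> x \<triangleright> m \<sqsubseteq> y \<triangleright> m"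
    and act_mono_right: "\<lbrakk>m \<in> carrier M; n \<in> carrier M; m \<sqsubseteq> n\<rbrakk> \<Longrightarrow> x \<triangleright> m \<sqsubseteq> x \<triangleright> n"
    and top_act: "m \<in> carrier M \<Longrightarrow> Orderings.top \<triangleright> m = m"
    and bot_act: "m \<in> carrier M \<Longrightarrow> Orderings.bot \<triangleright> m = \<bottom>"
    and inf_act: "m \<in> carrier M \<Longrightarrow> inf x y \<triangleright> m = x \<triangleright> (y \<triangleright> m)"
    and sup_act: "m \<in> carrier M \<Longrightarrow> sup x y \<triangleright> m = (x \<triangleright> m) \<squnion> (y \<triangleright> m)"
    and act_join: "\<lbrakk>m \<in> carrier M; n \<in> carrier M\<rbrakk> \<Longrightarrow> x \<triangleright> (m \<squnion> n) = (x \<triangleright> m) \<squnion> (x \<triangleright> n)"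

locale heyting_module = distributive_module +
  assumes residual_exists:
    "\<lbrakk>m \<in> carrier M; n \<in> carrier M\<rbrakk> \<Longrightarrow> \<exists>r. \<forall>x. x \<triangleright> m \<sqsubseteq> n \<longleftrightarrow> x \<le> r"

definition mod_hom :: "('h, 'a) hmod \<Rightarrow> ('h, 'b) hmod \<Rightarrow> ('a \<Rightarrow> 'b) set" where
  "mod_hom M N = {f \<in> carrier M \<rightarrow> carrier N.
     f \<bottom>\<^bsub>M\<^esub> = \<bottom>\<^bsub>N\<^esub> \<and>
     (\<forall>m\<in>carrier M. \<forall>n\<in>carrier M. f (m \<squnion>\<^bsub>M\<^esub> n) = f m \<squnion>\<^bsub>N\<^esub> f n) \<and>
     (\<forall>x. \<forall>m\<in>carrier M. f (x \<triangleright>\<^bsub>M\<^esub> m) = x \<triangleright>\<^bsub>N\<^esub> f m)}"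

definition mod_iso :: "('h, 'a) hmod \<Rightarrow> ('h, 'b) hmod \<Rightarrow> ('a \<Rightarrow> 'b) set" where
  "mod_iso M N = {f \<in> mod_hom M N. \<exists>g\<in>mod_hom N M.
     (\<forall>m\<in>carrier M. g (f m) = m) \<and> (\<forall>n\<in>carrier N. f (g n) = n)}"

definition mod_prod :: "('h, 'a) hmod \<Rightarrow> ('h, 'b) hmod \<Rightarrow> ('h, 'a \<times> 'b) hmod" where
  "mod_prod M N =
     \<lparr>carrier = carrier M \<times> carrier N, eq = (=),
      le = (\<lambda>p q. fst p \<sqsubseteq>\<^bsub>M\<^esub> fst q \<and> snd p \<sqsubseteq>\<^bsub>N\<^esub> snd q),
      act = (\<lambda>x p. (x \<triangleright>\<^bsub>M\<^esub> fst p, x \<triangleright>\<^bsub>N\<^esub> snd p))\<rparr>"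

(* Submodules carry the restricted structure, so they are equal iff their underlying sets are. *)
definition submod :: "('h, 'm) hmod \<Rightarrow> 'm set \<Rightarrow> ('h, 'm) hmod" where
  "submod M A = M\<lparr>carrier := A\<rparr>"

definition equalizer :: "('h, 'a) hmod \<Rightarrow> ('a \<Rightarrow> 'b) \<Rightarrow> ('a \<Rightarrow> 'b) \<Rightarrow> ('h, 'a) hmod" where
  "equalizer M u v = submod M {m \<in> carrier M. u m = v m}"

(* q : B -> Q is a coequalizer of u, v : A -> B among Heyting modules. HOL cannot quantify over
   all types of test objects inside a definition; Q and the test objects Z live on subsets of the
   type 'b set, which has room for a copy of every quotient of B. Nothing is lost: by
   is_coequalizer_universal below the universal property then holds for test objects on any type,
   and by coequalizer_exists such a Q exists when the base lattice is finite. *)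
definition is_coequalizer ::
  "('h :: {distrib_lattice, bounded_lattice}, 'a) hmod \<Rightarrow> ('h, 'b) hmod \<Rightarrow>
   ('a \<Rightarrow> 'b) \<Rightarrow> ('a \<Rightarrow> 'b) \<Rightarrow> ('h, 'b set) hmod \<Rightarrow> ('b \<Rightarrow> 'b set) \<Rightarrow> bool" where
  "is_coequalizer A B u v Q q \<longleftrightarrow>
     heyting_module Q \<and> q \<in> mod_hom B Q \<and> (\<forall>a\<in>carrier A. q (u a) = q (v a)) \<and>
     (\<forall>(Z :: ('h, 'b set) hmod) g.
        heyting_module Z \<and> g \<in> mod_hom B Z \<and> (\<forall>a\<in>carrier A. g (u a) = g (v a)) \<longrightarrow>
        (\<exists>h\<in>mod_hom Q Z. (\<forall>b\<in>carrier B. h (q b) = g b) \<and>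
           (\<forall>h'\<in>mod_hom Q Z. (\<forall>b\<in>carrier B. h' (q b) = g b) \<longrightarrow> (\<forall>x\<in>carrier Q. h' x = h x))))"

definition ker_pair :: "('h, 'm) hmod \<Rightarrow> ('m \<Rightarrow> 'n) \<Rightarrow> ('h, 'm \<times> 'm) hmod" where
  "ker_pair M f = equalizer (mod_prod M M) (f \<circ> fst) (f \<circ> snd)"

definition is_coimage ::
  "('h :: {distrib_lattice, bounded_lattice}, 'm) hmod \<Rightarrow> ('m \<Rightarrow> 'n) \<Rightarrow>
   ('h, 'm set) hmod \<Rightarrow> ('m \<Rightarrow> 'm set) \<Rightarrow> bool" where
  "is_coimage M f C c \<longleftrightarrow> is_coequalizer (ker_pair M f) M fst snd C c"

definition incl1 :: "('h, 'n) hmod \<Rightarrow> 'n \<Rightarrow> 'n \<times> 'n" where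
  "incl1 N n = (n, \<bottom>\<^bsub>N\<^esub>)"

definition incl2 :: "('h, 'n) hmod \<Rightarrow> 'n \<Rightarrow> 'n \<times> 'n" where
  "incl2 N n = (\<bottom>\<^bsub>N\<^esub>, n)"

definition is_coker_pair ::
  "('h :: {distrib_lattice, bounded_lattice}, 'm) hmod \<Rightarrow> ('h, 'n) hmod \<Rightarrow> ('m \<Rightarrow> 'n) \<Rightarrow>
   ('h, ('n \<times> 'n) set) hmod \<Rightarrow> ('n \<times> 'n \<Rightarrow> ('n \<times> 'n) set) \<Rightarrow> bool" where
  "is_coker_pair M N f K k \<longleftrightarrow>
     is_coequalizer M (mod_prod N N) (incl1 N \<circ> f) (incl2 N \<circ> f) K k"

(* The image Im(f), computed from a cokernel pair with quotient map k : N x N -> Coker_p(f). *)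
definition image_mod :: "('h, 'n) hmod \<Rightarrow> ('n \<times> 'n \<Rightarrow> 'k) \<Rightarrow> ('h, 'n) hmod" where
  "image_mod N k = equalizer N (k \<circ> incl1 N) (k \<circ> incl2 N)"

(* The set-theoretic range I_f of f. *)
definition range_mod :: "('h, 'm) hmod \<Rightarrow> ('h, 'n) hmod \<Rightarrow> ('m \<Rightarrow> 'n) \<Rightarrow> ('h, 'n) hmod" where
  "range_mod M N f = submod N (f ` carrier M)"


lemma (in distributive_module) join_bottom_eq: "m \<in> carrier M \<Longrightarrow> \<bottom> \<squnion> m = m" "m \<in> carrier M \<Longrightarrow> m \<squnion> \<bottom> = m"
proof -
  assume m: "m \<in> carrier M"
  have "m \<squnion> \<bottom> \<sqsubseteq> m" using m by (intro join_le) auto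
  moreover have "m \<sqsubseteq> m \<squnion> \<bottom>" using m by (intro join_left) auto
  ultimately show "m \<squnion> \<bottom> = m" using m by (intro le_antisym) auto
  then show "\<bottom> \<squnion> m = m" by (simp add: join_comm)
qed

lemma (in join_semilattice) le_iff_join_eq:
  assumes "m \<in> carrier L" "n \<in> carrier L"
  shows "m \<sqsubseteq> n \<longleftrightarrow> m \<squnion> n = n"
proof
  assume "m \<sqsubseteq> n"
  then show "m \<squnion> n = n"
    using assms by (intro le_antisym join_le join_right) auto
next
  assume "m \<squnion> n = n"
  then show "m \<sqsubseteq> n" using join_left[OF assms] by simp
qed

lemma (in partial_order) join_unique:
  assumes "s \<in> carrier L" "m \<in> carrier L" "n \<in> carrier L" "m \<sqsubseteq> s" "n \<sqsubseteq> s"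
    and "\<And>t. \<lbrakk>t \<in> carrier L; m \<sqsubseteq> t; n \<sqsubseteq> t\<rbrakk> \<Longrightarrow> s \<sqsubseteq> t"
  shows "least L s (Upper L {m, n})" "m \<squnion> n = s"
proof -
  show l: "least L s (Upper L {m, n})"
    using assms by (auto simp: least_def Upper_def)
  have "least L (SOME x. least L x (Upper L {m, n})) (Upper L {m, n})"
    using l by (rule someI)
  with l show "m \<squnion> n = s"
    unfolding join_def Lattice.sup_def by (metis least_unique)
qed

lemma (in partial_order) bottom_unique:
  assumes "b \<in> carrier L" "\<And>m. m \<in> carrier L \<Longrightarrow> b \<sqsubseteq> m"
  shows "least L b (carrier L)" "\<bottom> = b"
proof -
  show l: "least L b (carrier L)" using assms by (auto simp: least_def)
  have "least L (SOME x. least L x (carrier L)) (carrier L)"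
    using l by (rule someI)
  with l show "\<bottom> = b" unfolding bottom_def by (metis least_unique)
qed

lemma distributive_module_axiomsI:
  fixes P :: "('h :: {distrib_lattice, bounded_lattice}, 'p) hmod"
  assumes eq: "eq P = (=)"
    and refl: "\<And>a. a \<in> carrier P \<Longrightarrow> le P a a"
    and anti: "\<And>a b. \<lbrakk>a \<in> carrier P; b \<in> carrier P; le P a b; le P b a\<rbrakk> \<Longrightarrow> a = b"
    and trans: "\<And>a b c. \<lbrakk>a \<in> carrier P; b \<in> carrier P; c \<in> carrier P; le P a b; le P b c\<rbrakk> \<Longrightarrow> le P a c"
    and z: "z \<in> carrier P" "\<And>a. a \<in> carrier P \<Longrightarrow> le P z a"
    and j: "\<And>a b. \<lbrakk>a \<in> carrier P; b \<in> carrier P\<rbrakk> \<Longrightarrow> j a b \<in> carrier P"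
      "\<And>a b. \<lbrakk>a \<in> carrier P; b \<in> carrier P\<rbrakk> \<Longrightarrow> le P a (j a b)"
      "\<And>a b. \<lbrakk>a \<in> carrier P; b \<in> carrier P\<rbrakk> \<Longrightarrow> le P b (j a b)"
      "\<And>a b c. \<lbrakk>a \<in> carrier P; b \<in> carrier P; c \<in> carrier P; le P a c; le P b c\<rbrakk> \<Longrightarrow> le P (j a b) c"
    and act: "\<And>x a. a \<in> carrier P \<Longrightarrow> act P x a \<in> carrier P"
      "\<And>a. a \<in> carrier P \<Longrightarrow> act P Orderings.top a = a"
      "\<And>a. a \<in> carrier P \<Longrightarrow> act P Orderings.bot a = z"
      "\<And>x y a. a \<in> carrier P \<Longrightarrow> act P (inf x y) a = act P x (act P y a)"
      "\<And>x y a. a \<in> carrier P \<Longrightarrow> act P (sup x y) a = j (act P x a) (act P y a)"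
      "\<And>x a b. \<lbrakk>a \<in> carrier P; b \<in> carrier P\<rbrakk> \<Longrightarrow> act P x (j a b) = j (act P x a) (act P x b)"
  shows "distributive_module P"
    and "bottom P = z"
    and "\<lbrakk>a \<in> carrier P; b \<in> carrier P\<rbrakk> \<Longrightarrow> join P a b = j a b"
proof -
  interpret partial_order P
    by unfold_locales (use eq refl anti in \<open>auto intro: trans\<close>)
  note b = bottom_unique[OF z]
  show bz: "bottom P = z" by (rule b(2))
  have J: "least P (j a b) (Upper P {a, b})" "join P a b = j a b"
    if "a \<in> carrier P" "b \<in> carrier P" for a b
    using that by (auto intro!: join_unique j(1-3) intro: j(4))
  then show "\<lbrakk>a \<in> carrier P; b \<in> carrier P\<rbrakk> \<Longrightarrow> join P a b = j a b" by blast
  interpret join_semilattice P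
    by unfold_locales (use J b in blast)+
  show "distributive_module P"
  proof unfold_locales
    fix x y :: 'h and m assume "x \<le> y" and m: "m \<in> carrier P"
    then have "act P y m = j (act P x m) (act P y m)"
      using act(5)[OF m, of x y] by (simp add: sup.absorb2)
    then show "le P (act P x m) (act P y m)" using j(2) act(1) m by metis
  next
    fix x m n assume mn: "m \<in> carrier P" "n \<in> carrier P" "le P m n"
    then have "j m n = n" by (metis J(2) le_iff_join_eq)
    then have "act P x n = j (act P x m) (act P x n)" using act(6) mn by metis
    then show "le P (act P x m) (act P x n)" using j(2) act(1) mn by metis
  qed (use act J bz j in auto)
qed

(* Over a finite lattice the residuals are joins of finite sets, so they come for free. *)
lemma distributive_imp_heyting:
  fixes M :: "('h :: {finite, distrib_lattice, bounded_lattice}, 'm) hmod"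
  assumes "distributive_module M"
  shows "heyting_module M"
proof -
  interpret distributive_module M by fact
  show ?thesis
  proof unfold_locales
    fix m n assume mn: "m \<in> carrier M" "n \<in> carrier M"
    let ?S = "{x. le M (act M x m) n}"
    have ne: "Orderings.bot \<in> ?S" using mn by (simp add: bot_act)
    have F: "le M (act M (Sup_fin S) m) n" if "finite S" "S \<noteq> {}" "S \<subseteq> ?S" for S
      using that
    proof (induction rule: finite_ne_induct)
      case (insert x F)
      then show ?case using mn by (auto simp: sup_act intro!: join_le)
    qed auto
    have S: "le M (act M (Sup_fin ?S) m) n"
      by (rule F) (use ne in auto)
    have "le M (act M x m) n \<longleftrightarrow> x \<le> Sup_fin ?S" for x
    proof
      assume "le M (act M x m) n"
      then show "x \<le> Sup_fin ?S" by (intro Sup_fin.coboundedI) auto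
    next
      assume "x \<le> Sup_fin ?S"
      then show "le M (act M x m) n"
        by (rule le_trans[OF act_mono_left[OF _ mn(1)] S]) (simp_all add: mn)
    qed
    then show "\<exists>r. \<forall>x. le M (act M x m) n \<longleftrightarrow> x \<le> r" by (intro exI allI)
  qed
qed

lemma mod_homD:
  assumes "f \<in> mod_hom M N"
  shows "m \<in> carrier M \<Longrightarrow> f m \<in> carrier N" "f \<bottom>\<^bsub>M\<^esub> = \<bottom>\<^bsub>N\<^esub>"
    "\<lbrakk>m \<in> carrier M; n \<in> carrier M\<rbrakk> \<Longrightarrow> f (m \<squnion>\<^bsub>M\<^esub> n) = f m \<squnion>\<^bsub>N\<^esub> f n"
    "m \<in> carrier M \<Longrightarrow> f (x \<triangleright>\<^bsub>M\<^esub> m) = x \<triangleright>\<^bsub>N\<^esub> f m"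
  using assms by (auto simp: mod_hom_def)

lemma mod_hom_comp:
  assumes "f \<in> mod_hom L M" "g \<in> mod_hom M N"
  shows "(\<lambda>x. g (f x)) \<in> mod_hom L N"
  using assms by (auto simp: mod_hom_def Pi_iff)

lemma heyting_module_prod:
  assumes "heyting_module M" "heyting_module N"
  shows "heyting_module (mod_prod M N)"
    and "\<bottom>\<^bsub>mod_prod M N\<^esub> = (\<bottom>\<^bsub>M\<^esub>, \<bottom>\<^bsub>N\<^esub>)"
    and "\<lbrakk>p \<in> carrier (mod_prod M N); q \<in> carrier (mod_prod M N)\<rbrakk> \<Longrightarrow>
      p \<squnion>\<^bsub>mod_prod M N\<^esub> q = (fst p \<squnion>\<^bsub>M\<^esub> fst q, snd p \<squnion>\<^bsub>N\<^esub> snd q)"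
proof -
  interpret M: heyting_module M by fact
  interpret N: heyting_module N by fact
  let ?j = "\<lambda>p q. (fst p \<squnion>\<^bsub>M\<^esub> fst q, snd p \<squnion>\<^bsub>N\<^esub> snd q)"
  let ?z = "(\<bottom>\<^bsub>M\<^esub>, \<bottom>\<^bsub>N\<^esub>)"
  note I = distributive_module_axiomsI[where P = "mod_prod M N" and j = ?j and z = ?z]
  have D: "distributive_module (mod_prod M N) \<and> \<bottom>\<^bsub>mod_prod M N\<^esub> = ?z \<and>
     (\<forall>p\<in>carrier (mod_prod M N). \<forall>q\<in>carrier (mod_prod M N). p \<squnion>\<^bsub>mod_prod M N\<^esub> q = ?j p q)"
    by (intro conjI ballI I)
      (auto simp: mod_prod_def M.top_act N.top_act M.bot_act N.bot_act M.inf_act N.inf_act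
        M.sup_act N.sup_act M.act_join N.act_join
        intro: M.le_antisym N.le_antisym M.le_trans N.le_trans
          M.join_left N.join_left M.join_right N.join_right M.join_le N.join_le)
  then show "\<bottom>\<^bsub>mod_prod M N\<^esub> = ?z"
    and "\<lbrakk>p \<in> carrier (mod_prod M N); q \<in> carrier (mod_prod M N)\<rbrakk> \<Longrightarrow>
      p \<squnion>\<^bsub>mod_prod M N\<^esub> q = ?j p q" by blast+
  interpret distributive_module "mod_prod M N" using D by blast
  show "heyting_module (mod_prod M N)"
  proof unfold_locales
    fix p q assume pq: "p \<in> carrier (mod_prod M N)" "q \<in> carrier (mod_prod M N)"
    then obtain r s where "\<forall>x. act M x (fst p) \<sqsubseteq>\<^bsub>M\<^esub> fst q \<longleftrightarrow> x \<le> r"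
      "\<forall>x. act N x (snd p) \<sqsubseteq>\<^bsub>N\<^esub> snd q \<longleftrightarrow> x \<le> s"
      using M.residual_exists N.residual_exists by (fastforce simp: mod_prod_def)
    then have "\<forall>x. act (mod_prod M N) x p \<sqsubseteq>\<^bsub>mod_prod M N\<^esub> q \<longleftrightarrow> x \<le> inf r s"
      by (simp add: mod_prod_def)
    then show "\<exists>r. \<forall>x. act (mod_prod M N) x p \<sqsubseteq>\<^bsub>mod_prod M N\<^esub> q \<longleftrightarrow> x \<le> r" by blast
  qed
qed

lemma heyting_module_submod:
  assumes "heyting_module M" and "A \<subseteq> carrier M" and "\<bottom>\<^bsub>M\<^esub> \<in> A"
    and "\<And>m n. \<lbrakk>m \<in> A; n \<in> A\<rbrakk> \<Longrightarrow> m \<squnion>\<^bsub>M\<^esub> n \<in> A"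
    and "\<And>x m. m \<in> A \<Longrightarrow> x \<triangleright>\<^bsub>M\<^esub> m \<in> A"
  shows "heyting_module (submod M A)"
    and "\<bottom>\<^bsub>submod M A\<^esub> = \<bottom>\<^bsub>M\<^esub>"
    and "\<lbrakk>m \<in> A; n \<in> A\<rbrakk> \<Longrightarrow> m \<squnion>\<^bsub>submod M A\<^esub> n = m \<squnion>\<^bsub>M\<^esub> n"
proof -
  interpret M: heyting_module M by fact
  note A = subsetD[OF assms(2)] assms(3-5)
  note I = distributive_module_axiomsI[where P = "submod M A" and j = "join M" and z = "bottom M"]
  have D: "distributive_module (submod M A) \<and> \<bottom>\<^bsub>submod M A\<^esub> = \<bottom>\<^bsub>M\<^esub> \<and>
     (\<forall>p\<in>A. \<forall>q\<in>A. p \<squnion>\<^bsub>submod M A\<^esub> q = p \<squnion>\<^bsub>M\<^esub> q)"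
    by (intro conjI ballI I)
      (auto simp: submod_def A M.eq_is_equal M.top_act M.bot_act M.inf_act M.sup_act M.act_join
        intro: M.le_antisym M.le_trans M.join_left M.join_right M.join_le)
  then show "\<bottom>\<^bsub>submod M A\<^esub> = \<bottom>\<^bsub>M\<^esub>"
    and "\<lbrakk>m \<in> A; n \<in> A\<rbrakk> \<Longrightarrow> m \<squnion>\<^bsub>submod M A\<^esub> n = m \<squnion>\<^bsub>M\<^esub> n" by blast+
  interpret distributive_module "submod M A" using D by blast
  show "heyting_module (submod M A)"
    by unfold_locales (use M.residual_exists A in \<open>auto simp: submod_def\<close>)
qed

lemma heyting_module_range:
  assumes "heyting_module M" "heyting_module N" "f \<in> mod_hom M N"
  shows "heyting_module (range_mod M N f)" "f \<in> mod_hom M (range_mod M N f)"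
    "(\<lambda>n. n) \<in> mod_hom (range_mod M N f) N"
proof -
  interpret M: heyting_module M by fact
  interpret N: heyting_module N by fact
  note f = mod_homD[OF assms(3)]
  have c: "f ` carrier M \<subseteq> carrier N" "\<bottom>\<^bsub>N\<^esub> \<in> f ` carrier M"
    "\<And>m n. \<lbrakk>m \<in> f ` carrier M; n \<in> f ` carrier M\<rbrakk> \<Longrightarrow> m \<squnion>\<^bsub>N\<^esub> n \<in> f ` carrier M"
    "\<And>x m. m \<in> f ` carrier M \<Longrightarrow> x \<triangleright>\<^bsub>N\<^esub> m \<in> f ` carrier M"
    using f(1) by (auto simp: f(2)[symmetric] f(3)[symmetric] f(4)[symmetric])
  note S = heyting_module_submod[OF assms(2) c]
  show "heyting_module (range_mod M N f)" using S(1) by (simp add: range_mod_def)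
  show "f \<in> mod_hom M (range_mod M N f)" "(\<lambda>n. n) \<in> mod_hom (range_mod M N f) N"
    using f S(2,3) by (auto simp: mod_hom_def range_mod_def) (auto simp: submod_def)
qed

lemma heyting_module_equalizer:
  assumes "heyting_module M" "u \<in> mod_hom M N" "v \<in> mod_hom M N"
  shows "heyting_module (equalizer M u v)" "(\<lambda>m. m) \<in> mod_hom (equalizer M u v) M"
proof -
  interpret M: heyting_module M by fact
  have c: "{m \<in> carrier M. u m = v m} \<subseteq> carrier M" "\<bottom>\<^bsub>M\<^esub> \<in> {m \<in> carrier M. u m = v m}"
    "\<And>m n. \<lbrakk>m \<in> {m \<in> carrier M. u m = v m}; n \<in> {m \<in> carrier M. u m = v m}\<rbrakk>
      \<Longrightarrow> m \<squnion>\<^bsub>M\<^esub> n \<in> {m \<in> carrier M. u m = v m}"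
    "\<And>x m. m \<in> {m \<in> carrier M. u m = v m} \<Longrightarrow> x \<triangleright>\<^bsub>M\<^esub> m \<in> {m \<in> carrier M. u m = v m}"
    using mod_homD[OF assms(2)] mod_homD[OF assms(3)] by auto
  note S = heyting_module_submod[OF assms(1) c]
  show "heyting_module (equalizer M u v)" using S(1) by (simp add: equalizer_def)
  show "(\<lambda>m. m) \<in> mod_hom (equalizer M u v) M"
    using S(2,3) by (auto simp: mod_hom_def equalizer_def) (auto simp: submod_def)
qed

lemma equalizer_universal:
  assumes "heyting_module M" "u \<in> mod_hom M N" "v \<in> mod_hom M N"
    and "heyting_module Z" "g \<in> mod_hom Z M" "\<forall>z\<in>carrier Z. u (g z) = v (g z)"
  shows "g \<in> mod_hom Z (equalizer M u v)"
proof -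
  interpret M: heyting_module M by fact
  note g = mod_homD[OF assms(5)]
  have c: "{m \<in> carrier M. u m = v m} \<subseteq> carrier M" "\<bottom>\<^bsub>M\<^esub> \<in> {m \<in> carrier M. u m = v m}"
    "\<And>m n. \<lbrakk>m \<in> {m \<in> carrier M. u m = v m}; n \<in> {m \<in> carrier M. u m = v m}\<rbrakk>
      \<Longrightarrow> m \<squnion>\<^bsub>M\<^esub> n \<in> {m \<in> carrier M. u m = v m}"
    "\<And>x m. m \<in> {m \<in> carrier M. u m = v m} \<Longrightarrow> x \<triangleright>\<^bsub>M\<^esub> m \<in> {m \<in> carrier M. u m = v m}"
    using mod_homD[OF assms(2)] mod_homD[OF assms(3)] by auto
  note S = heyting_module_submod[OF assms(1) c]
  show ?thesis
    using g S(2,3) assms(6) by (auto simp: mod_hom_def equalizer_def) (auto simp: submod_def)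
qed

lemma heyting_module_transport:
  fixes M :: "('h :: {distrib_lattice, bounded_lattice}, 'a) hmod" and s :: "'a \<Rightarrow> 'b"
  assumes "heyting_module M" and s: "inj_on s (carrier M)"
  obtains P :: "('h, 'b) hmod" and t where "heyting_module P" "s \<in> mod_hom M P" "t \<in> mod_hom P M"
    "\<And>m. m \<in> carrier M \<Longrightarrow> t (s m) = m"
proof -
  interpret M: heyting_module M by fact
  define t where "t = inv_into (carrier M) s"
  have ts [simp]: "t (s m) = m" if "m \<in> carrier M" for m
    using s that by (simp add: t_def)
  have sc: "s a = s b" if "le M a b" "le M b a" "a \<in> carrier M" "b \<in> carrier M" for a b
    using M.le_antisym[OF that] by simp
  define P :: "('h, 'b) hmod" where "P = \<lparr>carrier = s ` carrier M, eq = (=),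
     le = (\<lambda>a b. t a \<sqsubseteq>\<^bsub>M\<^esub> t b), act = (\<lambda>x a. s (x \<triangleright>\<^bsub>M\<^esub> t a))\<rparr>"
  note I = distributive_module_axiomsI[where P = P and j = "\<lambda>a b. s (t a \<squnion>\<^bsub>M\<^esub> t b)" and z = "s \<bottom>\<^bsub>M\<^esub>"]
  have D: "distributive_module P \<and> \<bottom>\<^bsub>P\<^esub> = s \<bottom>\<^bsub>M\<^esub> \<and>
     (\<forall>p\<in>carrier P. \<forall>q\<in>carrier P. p \<squnion>\<^bsub>P\<^esub> q = s (t p \<squnion>\<^bsub>M\<^esub> t q))"
    by (intro conjI ballI I)
      (auto simp: P_def M.top_act M.bot_act M.inf_act M.sup_act M.act_join
        intro: M.join_left M.join_right M.join_le,
       ((rule sc; assumption) | (erule M.le_trans, assumption+))+)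
  interpret distributive_module P using D by blast
  have "heyting_module P"
    by unfold_locales (use M.residual_exists in \<open>auto simp: P_def\<close>)
  moreover have "s \<in> mod_hom M P" "t \<in> mod_hom P M"
    using D by (auto simp: mod_hom_def) (auto simp: P_def)
  ultimately show thesis using that ts by blast
qed

lemma is_coequalizer_factor:
  fixes Z :: "('h :: {distrib_lattice, bounded_lattice}, 'b set) hmod" and B :: "('h, 'b) hmod"
  assumes "is_coequalizer A B u v Q q"
    and "heyting_module Z" "g \<in> mod_hom B Z" "\<forall>a\<in>carrier A. g (u a) = g (v a)"
  obtains h where "h \<in> mod_hom Q Z" "\<forall>b\<in>carrier B. h (q b) = g b"
    "\<And>h' x. \<lbrakk>h' \<in> mod_hom Q Z; \<forall>b\<in>carrier B. h' (q b) = g b; x \<in> carrier Q\<rbrakk> \<Longrightarrow> h' x = h x"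
proof -
  have "\<exists>h\<in>mod_hom Q Z. (\<forall>b\<in>carrier B. h (q b) = g b) \<and>
      (\<forall>h'\<in>mod_hom Q Z. (\<forall>b\<in>carrier B. h' (q b) = g b) \<longrightarrow> (\<forall>x\<in>carrier Q. h' x = h x))"
    by (rule assms(1)[unfolded is_coequalizer_def, THEN conjunct2, THEN conjunct2, THEN conjunct2,
        THEN spec, THEN spec, THEN mp, OF conjI[OF assms(2) conjI[OF assms(3,4)]]])
  then show thesis by (elim bexE conjE) (rule that, auto)
qed

lemma is_coequalizer_surj:
  assumes B: "heyting_module B" and Q: "is_coequalizer A B u v Q q"
  shows "q ` carrier B = carrier Q"
proof -
  have q: "heyting_module Q" "q \<in> mod_hom B Q" "\<forall>a\<in>carrier A. q (u a) = q (v a)"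
    using Q by (simp_all add: is_coequalizer_def)
  note R = heyting_module_range[OF B q(1,2)]
  obtain h where h: "h \<in> mod_hom Q (range_mod B Q q)" "\<forall>b\<in>carrier B. h (q b) = q b"
    using is_coequalizer_factor[OF Q R(1,2) q(3)] by metis
  have h': "h \<in> mod_hom Q Q" using mod_hom_comp[OF h(1) R(3)] by simp
  have i: "(\<lambda>x. x) \<in> mod_hom Q Q" by (auto simp: mod_hom_def)
  obtain h0 where h0: "\<And>h' x. \<lbrakk>h' \<in> mod_hom Q Q; \<forall>b\<in>carrier B. h' (q b) = q b; x \<in> carrier Q\<rbrakk>
      \<Longrightarrow> h' x = h0 x"
    using is_coequalizer_factor[OF Q q] by metis
  have "h x = x" if "x \<in> carrier Q" for x
    using h0[OF h' h(2) that] h0[OF i _ that] by simp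
  then have "carrier Q \<subseteq> q ` carrier B"
    using mod_homD(1)[OF h(1)] by (force simp: range_mod_def submod_def)
  then show ?thesis using mod_homD(1)[OF q(2)] by auto
qed

theorem is_coequalizer_universal:
  fixes A :: "('h :: {distrib_lattice, bounded_lattice}, 'a) hmod" and Z :: "('h, 'z) hmod"
  assumes B: "heyting_module B" and Q: "is_coequalizer A B u v Q q"
    and Z: "heyting_module Z" and g: "g \<in> mod_hom B Z" "\<forall>a\<in>carrier A. g (u a) = g (v a)"
  shows "\<exists>h\<in>mod_hom Q Z. (\<forall>b\<in>carrier B. h (q b) = g b) \<and>
    (\<forall>h'\<in>mod_hom Q Z. (\<forall>b\<in>carrier B. h' (q b) = g b) \<longrightarrow> (\<forall>x\<in>carrier Q. h' x = h x))"
proof -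
  note R = heyting_module_range[OF B Z g(1)]
  define s where "s z = {b \<in> carrier B. g b = z}" for z
  have s: "inj_on s (carrier (range_mod B Z g))"
    by (auto simp: inj_on_def range_mod_def submod_def s_def)
  obtain P t where P: "heyting_module P" "s \<in> mod_hom (range_mod B Z g) P"
    "t \<in> mod_hom P (range_mod B Z g)" "\<And>m. m \<in> carrier (range_mod B Z g) \<Longrightarrow> t (s m) = m"
    using heyting_module_transport[OF R(1) s] by blast
  have c: "(\<lambda>b. s (g b)) \<in> mod_hom B P" by (rule mod_hom_comp[OF R(2) P(2)])
  have "\<forall>a\<in>carrier A. s (g (u a)) = s (g (v a))" using g(2) by simp
  from is_coequalizer_factor[OF Q P(1) c this]
  obtain h where h: "h \<in> mod_hom Q P" "\<forall>b\<in>carrier B. h (q b) = s (g b)" .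
  have "(\<lambda>x. t (h x)) \<in> mod_hom Q Z"
    using mod_hom_comp[OF mod_hom_comp[OF h(1) P(3)] R(3)] by simp
  moreover have "\<forall>b\<in>carrier B. t (h (q b)) = g b"
    using h(2) P(4) by (simp add: range_mod_def submod_def)
  moreover have "carrier Q = q ` carrier B" using is_coequalizer_surj[OF B Q] by simp
  ultimately show ?thesis by (intro bexI[of _ "\<lambda>x. t (h x)"]) auto
qed

lemma heyting_module_quotient:
  fixes B :: "('h :: {finite, distrib_lattice, bounded_lattice}, 'b) hmod" and q :: "'b \<Rightarrow> 'q"
  assumes "heyting_module B"
    and j: "\<And>a b a' b'. \<lbrakk>a \<in> carrier B; b \<in> carrier B; a' \<in> carrier B; b' \<in> carrier B;
      q a = q a'; q b = q b'\<rbrakk> \<Longrightarrow> q (a \<squnion>\<^bsub>B\<^esub> b) = q (a' \<squnion>\<^bsub>B\<^esub> b')"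
    and x: "\<And>x a a'. \<lbrakk>a \<in> carrier B; a' \<in> carrier B; q a = q a'\<rbrakk>
      \<Longrightarrow> q (x \<triangleright>\<^bsub>B\<^esub> a) = q (x \<triangleright>\<^bsub>B\<^esub> a')"
  obtains Q :: "('h, 'q) hmod" where "heyting_module Q" "carrier Q = q ` carrier B" "q \<in> mod_hom B Q"
proof -
  interpret B: heyting_module B by fact
  define t where "t = inv_into (carrier B) q"
  have t: "t (q a) \<in> carrier B" "q (t (q a)) = q a" if "a \<in> carrier B" for a
    using that by (auto simp: t_def inv_into_into f_inv_into_f)
  have tj [simp]: "q (t (q a) \<squnion>\<^bsub>B\<^esub> t (q b)) = q (a \<squnion>\<^bsub>B\<^esub> b)"
    if "a \<in> carrier B" "b \<in> carrier B" for a b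
    using that by (intro j t)
  have tx [simp]: "q (x \<triangleright>\<^bsub>B\<^esub> t (q a)) = q (x \<triangleright>\<^bsub>B\<^esub> a)" if "a \<in> carrier B" for x a
    using that by (intro x t)
  define Q :: "('h, 'q) hmod" where "Q = \<lparr>carrier = q ` carrier B, eq = (=),
     le = (\<lambda>a b. q (t a \<squnion>\<^bsub>B\<^esub> t b) = b), act = (\<lambda>x a. q (x \<triangleright>\<^bsub>B\<^esub> t a))\<rparr>"
  have assoc: "(a \<squnion>\<^bsub>B\<^esub> b) \<squnion>\<^bsub>B\<^esub> c = a \<squnion>\<^bsub>B\<^esub> (b \<squnion>\<^bsub>B\<^esub> c)"
    if "a \<in> carrier B" "b \<in> carrier B" "c \<in> carrier B" for a b c
    using B.weak_join_assoc[OF that] by (simp add: B.eq_is_equal)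
  have idem: "a \<squnion>\<^bsub>B\<^esub> a = a" if "a \<in> carrier B" for a
    using that B.le_iff_join_eq by auto
  have abs: "a \<squnion>\<^bsub>B\<^esub> (a \<squnion>\<^bsub>B\<^esub> b) = a \<squnion>\<^bsub>B\<^esub> b" if "a \<in> carrier B" "b \<in> carrier B" for a b
    using that by (simp add: assoc[symmetric] idem)
  have abs': "b \<squnion>\<^bsub>B\<^esub> (a \<squnion>\<^bsub>B\<^esub> b) = a \<squnion>\<^bsub>B\<^esub> b" if "a \<in> carrier B" "b \<in> carrier B" for a b
    using that abs[of b a] by (simp add: join_comm[of B])
  have anti: "q a = q b"
    if "q (a \<squnion>\<^bsub>B\<^esub> b) = q b" "q (b \<squnion>\<^bsub>B\<^esub> a) = q a" for a b
    using that by (simp add: join_comm[of B b a])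
  have trans: "q (a \<squnion>\<^bsub>B\<^esub> c) = q c"
    if "q (a \<squnion>\<^bsub>B\<^esub> b) = q b" "q (b \<squnion>\<^bsub>B\<^esub> c) = q c" "a \<in> carrier B" "b \<in> carrier B" "c \<in> carrier B"
    for a b c
  proof -
    have "q (a \<squnion>\<^bsub>B\<^esub> c) = q (a \<squnion>\<^bsub>B\<^esub> (b \<squnion>\<^bsub>B\<^esub> c))" using that by (intro j) auto
    also have "\<dots> = q ((a \<squnion>\<^bsub>B\<^esub> b) \<squnion>\<^bsub>B\<^esub> c)" using that by (simp add: assoc)
    also have "\<dots> = q (b \<squnion>\<^bsub>B\<^esub> c)" using that by (intro j) auto
    finally show ?thesis using that by simp
  qed
  have lub: "q ((a \<squnion>\<^bsub>B\<^esub> b) \<squnion>\<^bsub>B\<^esub> c) = q c"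
    if "a \<in> carrier B" "b \<in> carrier B" "c \<in> carrier B" "q (a \<squnion>\<^bsub>B\<^esub> c) = q c" "q (b \<squnion>\<^bsub>B\<^esub> c) = q c"
    for a b c
  proof -
    have "q ((a \<squnion>\<^bsub>B\<^esub> b) \<squnion>\<^bsub>B\<^esub> c) = q (a \<squnion>\<^bsub>B\<^esub> (b \<squnion>\<^bsub>B\<^esub> c))" using that by (simp add: assoc)
    also have "\<dots> = q (a \<squnion>\<^bsub>B\<^esub> c)" using that by (intro j) auto
    finally show ?thesis using that by simp
  qed
  note I = distributive_module_axiomsI[where P = Q and j = "\<lambda>a b. q (t a \<squnion>\<^bsub>B\<^esub> t b)" and z = "q \<bottom>\<^bsub>B\<^esub>"]
  have D: "distributive_module Q \<and> \<bottom>\<^bsub>Q\<^esub> = q \<bottom>\<^bsub>B\<^esub> \<and>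
     (\<forall>a\<in>carrier Q. \<forall>b\<in>carrier Q. a \<squnion>\<^bsub>Q\<^esub> b = q (t a \<squnion>\<^bsub>B\<^esub> t b))"
    by (intro conjI ballI I)
      (auto simp: Q_def B.top_act B.bot_act B.inf_act B.sup_act B.act_join B.join_bottom_eq
        idem abs abs' intro: lub,
       ((rule anti, assumption, assumption) | (rule trans, assumption+))+)
  show thesis
  proof (rule that)
    show "heyting_module Q" using D distributive_imp_heyting by blast
    show "carrier Q = q ` carrier B" by (simp add: Q_def)
    show "q \<in> mod_hom B Q" using D by (auto simp: mod_hom_def Q_def)
  qed
qed

theorem coequalizer_exists:
  fixes A :: "('h :: {finite, distrib_lattice, bounded_lattice}, 'a) hmod" and B :: "('h, 'b) hmod"
  assumes B: "heyting_module B" and uv: "u \<in> mod_hom A B" "v \<in> mod_hom A B"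
  shows "\<exists>Q q. is_coequalizer A B u v Q q"
proof -
  define cong :: "('b \<Rightarrow> 'b \<Rightarrow> bool) \<Rightarrow> bool" where "cong E \<longleftrightarrow>
     equivp E \<and> (\<forall>a\<in>carrier A. E (u a) (v a)) \<and>
     (\<forall>a\<in>carrier B. \<forall>b\<in>carrier B. \<forall>a'\<in>carrier B. \<forall>b'\<in>carrier B.
        E a a' \<longrightarrow> E b b' \<longrightarrow> E (a \<squnion>\<^bsub>B\<^esub> b) (a' \<squnion>\<^bsub>B\<^esub> b')) \<and>
     (\<forall>x. \<forall>a\<in>carrier B. \<forall>a'\<in>carrier B. E a a' \<longrightarrow> E (x \<triangleright>\<^bsub>B\<^esub> a) (x \<triangleright>\<^bsub>B\<^esub> a'))" for E
  define R where "R a b \<longleftrightarrow> (\<forall>E. cong E \<longrightarrow> E a b)" for a b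
  have ce: "equivp E" if "cong E" for E
    using that unfolding cong_def by (rule conjunct1)
  have cu: "E (u a) (v a)" if "cong E" "a \<in> carrier A" for E a
    using that(1)[unfolded cong_def, THEN conjunct2, THEN conjunct1] that(2) by (rule bspec)
  have cj: "E (a \<squnion>\<^bsub>B\<^esub> b) (a' \<squnion>\<^bsub>B\<^esub> b')" if "cong E" "a \<in> carrier B" "b \<in> carrier B"
    "a' \<in> carrier B" "b' \<in> carrier B" "E a a'" "E b b'" for E a b a' b'
    by (rule that(1)[unfolded cong_def, THEN conjunct2, THEN conjunct2, THEN conjunct1,
          THEN bspec, THEN bspec, THEN bspec, THEN bspec, THEN mp, THEN mp]) (fact that)+
  have cx: "E (x \<triangleright>\<^bsub>B\<^esub> a) (x \<triangleright>\<^bsub>B\<^esub> a')" if "cong E" "a \<in> carrier B" "a' \<in> carrier B" "E a a'"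
    for E x a a'
    by (rule that(1)[unfolded cong_def, THEN conjunct2, THEN conjunct2, THEN conjunct2,
          THEN spec, THEN bspec, THEN bspec, THEN mp]) (fact that)+
  have RI: "R a b" if "\<And>E. cong E \<Longrightarrow> E a b" for a b
    unfolding R_def by (intro allI impI) (fact that)
  have RD: "E a b" if "R a b" "cong E" for a b E
    by (rule that(1)[unfolded R_def, THEN spec, THEN mp, OF that(2)])
  have "R a a" for a
    by (rule RI) (rule equivp_reflp[OF ce])
  moreover have "R b a" if "R a b" for a b
    by (rule RI) (rule equivp_symp[OF ce RD[OF that]])
  moreover have "R a c" if "R a b" "R b c" for a b c
    by (rule RI) (rule equivp_transp[OF ce RD[OF that(1)] RD[OF that(2)]])
  ultimately have e: "equivp R"
    by (intro equivpI reflpI sympI transpI)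
  define q where "q a = Collect (R a)" for a
  have q: "q a = q b \<longleftrightarrow> R a b" for a b
  proof -
    have "q a = q b \<longleftrightarrow> R a = R b" by (auto simp: q_def)
    then show ?thesis using equivp_def[THEN iffD1, OF e, THEN spec, THEN spec, of a b] by simp
  qed
  have qj: "q (a \<squnion>\<^bsub>B\<^esub> b) = q (a' \<squnion>\<^bsub>B\<^esub> b')" if "a \<in> carrier B" "b \<in> carrier B" "a' \<in> carrier B"
    "b' \<in> carrier B" "q a = q a'" "q b = q b'" for a b a' b'
    unfolding q by (rule RI) (rule cj[OF _ that(1-4) RD[OF that(5)[unfolded q]] RD[OF that(6)[unfolded q]]])
  have qx: "q (x \<triangleright>\<^bsub>B\<^esub> a) = q (x \<triangleright>\<^bsub>B\<^esub> a')" if "a \<in> carrier B" "a' \<in> carrier B" "q a = q a'" for x a a'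
    unfolding q by (rule RI) (rule cx[OF _ that(1,2) RD[OF that(3)[unfolded q]]])
  obtain Q :: "('h, 'b set) hmod" where Q: "heyting_module Q" "carrier Q = q ` carrier B"
    "q \<in> mod_hom B Q"
    by (rule heyting_module_quotient[OF B qj qx])
  have "is_coequalizer A B u v Q q"
    unfolding is_coequalizer_def
  proof (intro conjI allI impI Q ballI)
    show "q (u a) = q (v a)" if "a \<in> carrier A" for a
      unfolding q by (rule RI) (rule cu[OF _ that])
  next
    fix Z :: "('h, 'b set) hmod" and g
    assume "heyting_module Z \<and> g \<in> mod_hom B Z \<and> (\<forall>a\<in>carrier A. g (u a) = g (v a))"
    then have g: "heyting_module Z" "g \<in> mod_hom B Z" "\<forall>a\<in>carrier A. g (u a) = g (v a)" by auto
    note G = mod_homD[OF g(2)]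
    have "equivp (\<lambda>a b. g a = g b)"
      by (intro equivpI reflpI sympI transpI) simp_all
    then have k: "cong (\<lambda>a b. g a = g b)"
      using g(3) unfolding cong_def by (simp add: G(3,4))
    have ke: "g a = g b" if "q a = q b" for a b
      by (rule RD[OF that[unfolded q] k])
    have inv: "g (inv_into (carrier B) q (q b)) = g b" if "b \<in> carrier B" for b
      by (rule ke) (rule f_inv_into_f[OF imageI[OF that]])
    let ?h = "\<lambda>x. g (inv_into (carrier B) q x)"
    interpret B: heyting_module B by fact
    note q' = mod_homD(2-4)[OF Q(3), symmetric]
    have "?h \<in> mod_hom Q Z"
      unfolding mod_hom_def by (auto simp: Q(2) q' inv G)
    then show "\<exists>h\<in>mod_hom Q Z. (\<forall>b\<in>carrier B. h (q b) = g b) \<and>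
        (\<forall>h'\<in>mod_hom Q Z. (\<forall>b\<in>carrier B. h' (q b) = g b) \<longrightarrow> (\<forall>x\<in>carrier Q. h' x = h x))"
      by (intro bexI[of _ ?h]) (auto simp: inv Q(2))
  qed
  then show ?thesis by (intro exI)
qed

end

theory Submission
  imports Defs
begin

(* That Coim(f) is I_f is formal, as is the inclusion of I_f in Im(f). For the converse, let n in N
   satisfy k(n, 0) = k(0, n). Any two morphisms from N that agree on I_f then agree at n. Every
   nonempty join-closed subset D of N gives a morphism m |-> -(m -> D) from N to H, where (m -> D) is
   the greatest x whose action takes m below some element of D: the complement turns the
   contravariant residual into a morphism. For D = {n} and D = {i in I_f. i <= n} these agree on
   I_f, and equality at n says that n lies below some i <= n in I_f, so n = i. *)

section \<open>The coimage as the range\<close>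

lemma bij_hom_imp_iso:
  fixes M :: "('h :: {distrib_lattice, bounded_lattice}, 'm) hmod" and N :: "('h, 'n) hmod"
  assumes "heyting_module M" and f: "f \<in> mod_hom M N" and bij: "bij_betw f (carrier M) (carrier N)"
  shows "f \<in> mod_iso M N"
proof -
  interpret M: heyting_module M by fact
  note h = mod_homD[OF f]
  define g where "g = inv_into (carrier M) f"
  have gf: "g (f m) = m" if "m \<in> carrier M" for m
    using bij that by (simp add: g_def bij_betw_inv_into_left)
  have fg: "f (g n) = n" "g n \<in> carrier M" if "n \<in> carrier N" for n
    using bij that bij_betw_inv_into_right[OF bij] bij_betw_apply[OF bij_betw_inv_into[OF bij]]
    by (simp_all add: g_def)
  \<comment> \<open>Each law for \<open>g\<close> comes from applying \<open>gf\<close> to the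
    claimed value in M and pushing \<open>f\<close> inward with \<open>h\<close>.\<close>
  have "g \<bottom>\<^bsub>N\<^esub> = \<bottom>\<^bsub>M\<^esub>"
    using gf[of "\<bottom>\<^bsub>M\<^esub>"] h(2) by simp
  moreover have "g (a \<squnion>\<^bsub>N\<^esub> b) = g a \<squnion>\<^bsub>M\<^esub> g b" if "a \<in> carrier N" "b \<in> carrier N" for a b
    using gf[of "g a \<squnion>\<^bsub>M\<^esub> g b"] h(3)[of "g a" "g b"] fg that by simp
  moreover have "g (x \<triangleright>\<^bsub>N\<^esub> a) = x \<triangleright>\<^bsub>M\<^esub> g a" if "a \<in> carrier N" for x a
    using gf[of "x \<triangleright>\<^bsub>M\<^esub> g a"] h(4)[of "g a" x] fg that by simp
  ultimately have "g \<in> mod_hom N M"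
    using fg(2) by (simp add: mod_hom_def)
  then show ?thesis using f gf fg(1) by (auto simp: mod_iso_def)
qed

lemma is_coequalizerD:
  assumes "is_coequalizer A B u v Q q"
  shows "heyting_module Q" "a \<in> carrier A \<Longrightarrow> q (u a) = q (v a)"
  using assms by (simp_all add: is_coequalizer_def)

text \<open>The comparison map is surjective because every value of \<open>f\<close> is attained. It
  is injective because \<open>c\<close> is surjective and already identifies any two elements with
  the same value under \<open>f\<close>: such a pair lies in the kernel pair.\<close>

theorem coimage_iso_range:
  fixes M :: "('h :: {distrib_lattice, bounded_lattice}, 'm) hmod" and N :: "('h, 'n) hmod"
  assumes M: "heyting_module M" and N: "heyting_module N" and f: "f \<in> mod_hom M N"
    and C: "is_coimage M f C c"
  shows "\<exists>\<phi>\<in>mod_iso C (range_mod M N f). \<forall>m\<in>carrier M. \<phi> (c m) = f m"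
proof -
  have Q: "is_coequalizer (ker_pair M f) M fst snd C c"
    using C by (simp add: is_coimage_def)
  have ker: "carrier (ker_pair M f) = {(m, m'). m \<in> carrier M \<and> m' \<in> carrier M \<and> f m = f m'}"
    by (auto simp: ker_pair_def equalizer_def submod_def mod_prod_def)
  have cc: "c m = c m'"
    if "m \<in> carrier M" "m' \<in> carrier M" "f m = f m'" for m m'
    using is_coequalizerD(2)[OF Q, of "(m, m')"] that by (simp add: ker)
  note R = heyting_module_range[OF M N f]
  \<comment> \<open>The range lives on the type of N, not on sets over the type of M, so the
    universal property is needed for test objects on arbitrary types.\<close>
  obtain \<phi> where \<phi>: "\<phi> \<in> mod_hom C (range_mod M N f)" "\<forall>m\<in>carrier M. \<phi> (c m) = f m"
    using is_coequalizer_universal[OF M Q R(1,2)] by (auto simp: ker)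
  have C: "carrier C = c ` carrier M"
    using is_coequalizer_surj[OF M Q] by simp
  have "inj_on \<phi> (carrier C)"
    unfolding C
  proof (rule inj_onI, elim imageE)
    fix x y m m' assume "\<phi> x = \<phi> y" "x = c m" "y = c m'" "m \<in> carrier M" "m' \<in> carrier M"
    then show "x = y" using \<phi>(2) cc[of m m'] by simp
  qed
  moreover have "\<phi> ` carrier C = carrier (range_mod M N f)"
    using \<phi>(2) by (simp add: C image_image range_mod_def submod_def)
  ultimately have "bij_betw \<phi> (carrier C) (carrier (range_mod M N f))"
    by (rule bij_betw_imageI)
  from bij_hom_imp_iso[OF is_coequalizerD(1)[OF Q] \<phi>(1) this] \<phi>(2) show ?thesis by blast
qed

section \<open>Morphisms into the base lattice\<close>

text \<open>H as a module over itself, the common target of the morphisms that separate elements of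
  N.\<close>

definition lattice_mod :: "('h :: {distrib_lattice, bounded_lattice}, 'h) hmod" where
  "lattice_mod = \<lparr>carrier = UNIV, eq = (=), le = (\<le>), act = inf\<rparr>"

lemma lattice_mod_simps [simp]:
  "carrier lattice_mod = UNIV" "x \<triangleright>\<^bsub>lattice_mod\<^esub> y = inf x y"
  by (simp_all add: lattice_mod_def)

lemma lattice_mod:
  shows distributive_module_lattice_mod:
      "distributive_module (lattice_mod :: ('h :: {distrib_lattice, bounded_lattice}, 'h) hmod)"
    and bottom_lattice_mod [simp]: "\<bottom>\<^bsub>lattice_mod\<^esub> = (Orderings.bot :: 'h)"
    and join_lattice_mod [simp]: "a \<squnion>\<^bsub>lattice_mod\<^esub> b = (sup a b :: 'h)"
proof -
  note I = distributive_module_axiomsI[where P = "lattice_mod :: ('h, 'h) hmod"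
      and j = Lattices.sup and z = Orderings.bot]
  have D: "distributive_module (lattice_mod :: ('h, 'h) hmod) \<and>
      \<bottom>\<^bsub>lattice_mod\<^esub> = (Orderings.bot :: 'h) \<and>
      (\<forall>a\<in>carrier lattice_mod. \<forall>b\<in>carrier lattice_mod. a \<squnion>\<^bsub>lattice_mod\<^esub> b = (sup a b :: 'h))"
    by (intro conjI ballI I)
      (auto simp: lattice_mod_def inf_sup_distrib1 inf_sup_distrib2 inf_assoc)
  then show "distributive_module (lattice_mod :: ('h, 'h) hmod)"
    "\<bottom>\<^bsub>lattice_mod\<^esub> = (Orderings.bot :: 'h)" "a \<squnion>\<^bsub>lattice_mod\<^esub> b = (sup a b :: 'h)"
    by auto
qed

text \<open>The admissible x form an ideal of H: it contains the least element since D is nonempty,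
  it is downward closed since the action is monotone, and it is closed under \<open>sup\<close>
  since witnesses in D can be joined. As H is finite, the ideal is principal.\<close>

lemma residual_set_exists:
  fixes N :: "('h :: {finite, distrib_lattice, bounded_lattice}, 'n) hmod"
  assumes "heyting_module N" and D: "D \<subseteq> carrier N" "D \<noteq> {}"
    and join: "\<And>d e. \<lbrakk>d \<in> D; e \<in> D\<rbrakk> \<Longrightarrow> d \<squnion>\<^bsub>N\<^esub> e \<in> D"
    and m: "m \<in> carrier N"
  shows "\<exists>r. \<forall>x. x \<le> r \<longleftrightarrow> (\<exists>d\<in>D. x \<triangleright>\<^bsub>N\<^esub> m \<sqsubseteq>\<^bsub>N\<^esub> d)"
proof -
  interpret N: heyting_module N by fact
  let ?S = "{x. \<exists>d\<in>D. x \<triangleright>\<^bsub>N\<^esub> m \<sqsubseteq>\<^bsub>N\<^esub> d}"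
  have bot: "Orderings.bot \<in> ?S" using D m by (auto simp: N.bot_act subset_eq)
  have sup: "sup x y \<in> ?S" if "x \<in> ?S" "y \<in> ?S" for x y
  proof -
    from that obtain d e where de: "d \<in> D" "e \<in> D" "x \<triangleright>\<^bsub>N\<^esub> m \<sqsubseteq>\<^bsub>N\<^esub> d" "y \<triangleright>\<^bsub>N\<^esub> m \<sqsubseteq>\<^bsub>N\<^esub> e"
      by blast
    then have c: "d \<in> carrier N" "e \<in> carrier N" using D by auto
    have "x \<triangleright>\<^bsub>N\<^esub> m \<sqsubseteq>\<^bsub>N\<^esub> d \<squnion>\<^bsub>N\<^esub> e" "y \<triangleright>\<^bsub>N\<^esub> m \<sqsubseteq>\<^bsub>N\<^esub> d \<squnion>\<^bsub>N\<^esub> e"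
      using N.le_trans[OF de(3) N.join_left[OF c]] N.le_trans[OF de(4) N.join_right[OF c]] c m
      by auto
    then have "sup x y \<triangleright>\<^bsub>N\<^esub> m \<sqsubseteq>\<^bsub>N\<^esub> d \<squnion>\<^bsub>N\<^esub> e"
      using c m by (auto simp: N.sup_act intro: N.join_le)
    then show ?thesis using join de by blast
  qed
  have "Sup_fin S \<in> ?S" if "finite S" "S \<noteq> {}" "S \<subseteq> ?S" for S
    using that
  proof (induction rule: finite_ne_induct)
    case (insert x F)
    then have "Sup_fin (insert x F) = sup x (Sup_fin F)" by simp
    with insert sup[of x "Sup_fin F"] show ?case by simp
  qed simp
  \<comment> \<open>\<open>Sup_fin\<close> is meaningful only on nonempty sets; \<open>bot\<close>
    supplies an element.\<close>
  from this[OF finite _ subset_refl] have top: "Sup_fin ?S \<in> ?S" using bot by fast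
  have "x \<le> Sup_fin ?S \<longleftrightarrow> x \<in> ?S" for x
  proof
    assume x: "x \<le> Sup_fin ?S"
    from top obtain d where d: "d \<in> D" "Sup_fin ?S \<triangleright>\<^bsub>N\<^esub> m \<sqsubseteq>\<^bsub>N\<^esub> d" by blast
    have "x \<triangleright>\<^bsub>N\<^esub> m \<sqsubseteq>\<^bsub>N\<^esub> d"
      by (rule N.le_trans[OF N.act_mono_left[OF x m] d(2)]) (use d D m in auto)
    then show "x \<in> ?S" using d by blast
  qed (rule Sup_fin.coboundedI, simp_all)
  then show ?thesis by blast
qed

text \<open>The residual r turns joins into meets and the action of y into the implication from y,
  so it is not a morphism itself. By De Morgan its complement is one; this is where H has to be
  Boolean rather than merely Heyting.\<close>

lemma residual_set_hom:
  fixes N :: "('h :: {finite, boolean_algebra}, 'n) hmod"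
  assumes "heyting_module N" and D: "D \<subseteq> carrier N" "D \<noteq> {}"
    and join: "\<And>d e. \<lbrakk>d \<in> D; e \<in> D\<rbrakk> \<Longrightarrow> d \<squnion>\<^bsub>N\<^esub> e \<in> D"
  shows "\<exists>g\<in>mod_hom N lattice_mod. \<forall>m\<in>carrier N. \<forall>x.
    x \<le> - g m \<longleftrightarrow> (\<exists>d\<in>D. x \<triangleright>\<^bsub>N\<^esub> m \<sqsubseteq>\<^bsub>N\<^esub> d)"
proof -
  interpret N: heyting_module N by fact
  obtain r where r: "\<And>m x. m \<in> carrier N \<Longrightarrow> x \<le> r m \<longleftrightarrow> (\<exists>d\<in>D. x \<triangleright>\<^bsub>N\<^esub> m \<sqsubseteq>\<^bsub>N\<^esub> d)"
    using residual_set_exists[OF assms] by metis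
  have Dc: "d \<in> carrier N" if "d \<in> D" for d using D that by blast
  have bot: "r \<bottom>\<^bsub>N\<^esub> = Orderings.top"
    using r[of "\<bottom>\<^bsub>N\<^esub>" Orderings.top] D by (auto simp: N.top_act top_unique)
  have inf: "r (a \<squnion>\<^bsub>N\<^esub> b) = inf (r a) (r b)" if ab: "a \<in> carrier N" "b \<in> carrier N" for a b
  proof -
    \<comment> \<open>Elements of H are compared through the elements below them. Left to right, one
      d serves both a and b; right to left, the two witnesses are replaced by their join in
      D.\<close>
    have "x \<le> r (a \<squnion>\<^bsub>N\<^esub> b) \<longleftrightarrow> x \<le> r a \<and> x \<le> r b" for x
    proof
      assume "x \<le> r (a \<squnion>\<^bsub>N\<^esub> b)"
      then obtain d where d: "d \<in> D" "(x \<triangleright>\<^bsub>N\<^esub> a) \<squnion>\<^bsub>N\<^esub> (x \<triangleright>\<^bsub>N\<^esub> b) \<sqsubseteq>\<^bsub>N\<^esub> d"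
        using ab by (auto simp: r N.act_join)
      have "x \<triangleright>\<^bsub>N\<^esub> a \<sqsubseteq>\<^bsub>N\<^esub> d" "x \<triangleright>\<^bsub>N\<^esub> b \<sqsubseteq>\<^bsub>N\<^esub> d"
        using N.le_trans[OF N.join_left d(2)] N.le_trans[OF N.join_right d(2)] ab d Dc by auto
      then show "x \<le> r a \<and> x \<le> r b" using d ab by (auto simp: r)
    next
      assume "x \<le> r a \<and> x \<le> r b"
      then obtain d e where de: "d \<in> D" "e \<in> D" "x \<triangleright>\<^bsub>N\<^esub> a \<sqsubseteq>\<^bsub>N\<^esub> d" "x \<triangleright>\<^bsub>N\<^esub> b \<sqsubseteq>\<^bsub>N\<^esub> e"
        using ab by (auto simp: r)
      note c = Dc[OF de(1)] Dc[OF de(2)]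
      have "x \<triangleright>\<^bsub>N\<^esub> a \<sqsubseteq>\<^bsub>N\<^esub> d \<squnion>\<^bsub>N\<^esub> e" "x \<triangleright>\<^bsub>N\<^esub> b \<sqsubseteq>\<^bsub>N\<^esub> d \<squnion>\<^bsub>N\<^esub> e"
        using N.le_trans[OF de(3) N.join_left[OF c]] N.le_trans[OF de(4) N.join_right[OF c]] c ab
        by auto
      then have "x \<triangleright>\<^bsub>N\<^esub> (a \<squnion>\<^bsub>N\<^esub> b) \<sqsubseteq>\<^bsub>N\<^esub> d \<squnion>\<^bsub>N\<^esub> e"
        using c ab by (auto simp: N.act_join intro: N.join_le)
      then show "x \<le> r (a \<squnion>\<^bsub>N\<^esub> b)" using join de ab by (auto simp: r)
    qed
    then show ?thesis by (intro antisym) (auto simp: r)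
  qed
  have act: "r (y \<triangleright>\<^bsub>N\<^esub> a) = sup (- y) (r a)" if a: "a \<in> carrier N" for y a
  proof -
    have "x \<le> r (y \<triangleright>\<^bsub>N\<^esub> a) \<longleftrightarrow> inf x y \<le> r a" for x
      using a by (simp add: r N.inf_act)
    \<comment> \<open>In a Boolean algebra the implication from y to \<open>r a\<close> is
      \<open>sup (- y) (r a)\<close>.\<close>
    moreover have "inf x y \<le> r a \<longleftrightarrow> x \<le> sup (- y) (r a)" for x
      by (metis inf_commute shunt1)
    ultimately show ?thesis by (intro antisym) blast+
  qed
  show ?thesis
  proof (rule bexI[of _ "\<lambda>m. - r m"])
    show "(\<lambda>m. - r m) \<in> mod_hom N lattice_mod"
      by (simp add: mod_hom_def bot inf act)
  qed (simp add: r)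
qed

section \<open>The image and the range\<close>

text \<open>Since N x N is also a coproduct, g and g' combine to a morphism on it. Agreement on the
  range of \<open>f\<close> makes that morphism factor through \<open>k\<close>, and
  \<open>k\<close> identifies (n, 0) with (0, n), where it takes the values \<open>g n\<close> and
  \<open>g' n\<close>.\<close>

lemma coker_pair_separates:
  fixes N :: "('h :: {distrib_lattice, bounded_lattice}, 'n) hmod" and Z :: "('h, 'z) hmod"
  assumes N: "heyting_module N" and K: "is_coker_pair M N f K k" and f: "f \<in> mod_hom M N"
    and Z: "heyting_module Z" and g: "g \<in> mod_hom N Z" "g' \<in> mod_hom N Z"
    and eq: "\<And>m. m \<in> carrier M \<Longrightarrow> g (f m) = g' (f m)"
    and n: "n \<in> carrier (image_mod N k)"
  shows "g n = g' n"
proof -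
  interpret N: heyting_module N by fact
  interpret Z: heyting_module Z by fact
  note P = heyting_module_prod[OF N N]
  note G = mod_homD[OF g(1)] and G' = mod_homD[OF g(2)]
  let ?s = "\<lambda>p. g (fst p) \<squnion>\<^bsub>Z\<^esub> g' (snd p)"
  \<comment> \<open>This is what makes the copairing \<open>?s\<close> preserve joins, which are
    componentwise in N x N.\<close>
  have interchange: "(a \<squnion>\<^bsub>Z\<^esub> b) \<squnion>\<^bsub>Z\<^esub> (c \<squnion>\<^bsub>Z\<^esub> d) = (a \<squnion>\<^bsub>Z\<^esub> c) \<squnion>\<^bsub>Z\<^esub> (b \<squnion>\<^bsub>Z\<^esub> d)"
    if "a \<in> carrier Z" "b \<in> carrier Z" "c \<in> carrier Z" "d \<in> carrier Z" for a b c d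
  proof -
    have A: "(x \<squnion>\<^bsub>Z\<^esub> y) \<squnion>\<^bsub>Z\<^esub> z = x \<squnion>\<^bsub>Z\<^esub> (y \<squnion>\<^bsub>Z\<^esub> z)"
      if "x \<in> carrier Z" "y \<in> carrier Z" "z \<in> carrier Z" for x y z
      using Z.weak_join_assoc[OF that] by (simp add: Z.eq_is_equal)
    show ?thesis
      using that A[of b c d] A[of c b d] by (simp add: A join_comm[of Z b c])
  qed
  have s: "?s \<in> mod_hom (mod_prod N N) Z"
    unfolding mod_hom_def
    by (auto simp: P G G' Z.join_bottom_eq interchange)
      (auto simp: mod_prod_def G G' Z.act_join interchange)
  have s1: "?s (incl1 N m) = g m" and s2: "?s (incl2 N m) = g' m" if "m \<in> carrier N" for m
    using that by (simp_all add: incl1_def incl2_def G G' Z.join_bottom_eq)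
  have "\<forall>m\<in>carrier M. ?s ((incl1 N \<circ> f) m) = ?s ((incl2 N \<circ> f) m)"
    using s1 s2 eq mod_homD(1)[OF f] by simp
  from is_coequalizer_universal[OF P(1) K[unfolded is_coker_pair_def] Z s this]
  obtain h where h: "\<forall>p\<in>carrier (mod_prod N N). h (k p) = ?s p" by blast
  have n: "n \<in> carrier N" "k (incl1 N n) = k (incl2 N n)"
    using n by (auto simp: image_mod_def equalizer_def submod_def)
  have "incl1 N n \<in> carrier (mod_prod N N)" "incl2 N n \<in> carrier (mod_prod N N)"
    using n by (simp_all add: incl1_def incl2_def mod_prod_def)
  then show ?thesis using h s1[OF n(1)] s2[OF n(1)] n(2) by metis
qed

theorem range_eq_image:
  fixes N :: "('h :: {finite, boolean_algebra}, 'n) hmod"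
  assumes M: "heyting_module M" and N: "heyting_module N" and f: "f \<in> mod_hom M N"
    and K: "is_coker_pair M N f K k"
  shows "range_mod M N f = image_mod N k"
proof -
  interpret M: heyting_module M by fact
  interpret N: heyting_module N by fact
  note F = mod_homD[OF f]
  have "n \<in> f ` carrier M" if n: "n \<in> carrier (image_mod N k)" for n
  proof -
    have nN: "n \<in> carrier N" using n by (simp add: image_mod_def equalizer_def submod_def)
    let ?D = "{i \<in> f ` carrier M. i \<sqsubseteq>\<^bsub>N\<^esub> n}"
    have "{n} \<subseteq> carrier N" "{n} \<noteq> {}" "\<And>d e. \<lbrakk>d \<in> {n}; e \<in> {n}\<rbrakk> \<Longrightarrow> d \<squnion>\<^bsub>N\<^esub> e \<in> {n}"
      using nN N.le_iff_join_eq[of n n] by auto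
    from residual_set_hom[OF N this]
    obtain g where g: "g \<in> mod_hom N lattice_mod"
      "\<And>m x. m \<in> carrier N \<Longrightarrow> x \<le> - g m \<longleftrightarrow> x \<triangleright>\<^bsub>N\<^esub> m \<sqsubseteq>\<^bsub>N\<^esub> n"
      by auto
    have sub: "?D \<subseteq> carrier N" using F(1) by auto
    \<comment> \<open>The least element of N is the value of \<open>f\<close> at the least element
      of M, so it is in \<open>?D\<close>.\<close>
    have ne: "?D \<noteq> {}" using F(2) nN by (auto intro!: bexI[of _ "\<bottom>\<^bsub>M\<^esub>"])
    have join: "d \<squnion>\<^bsub>N\<^esub> e \<in> ?D" if "d \<in> ?D" "e \<in> ?D" for d e
      using that nN F(1) by (auto simp: F(3)[symmetric]) (simp add: F(1,3) N.join_le)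
    from residual_set_hom[OF N sub ne join]
    obtain g' where g': "g' \<in> mod_hom N lattice_mod"
      "\<And>m x. m \<in> carrier N \<Longrightarrow> x \<le> - g' m \<longleftrightarrow> (\<exists>d\<in>?D. x \<triangleright>\<^bsub>N\<^esub> m \<sqsubseteq>\<^bsub>N\<^esub> d)"
      by blast
    have agree: "g (f m) = g' (f m)" if m: "m \<in> carrier M" for m
    proof -
      \<comment> \<open>The range is closed under the action, so x acting on \<open>f m\<close>,
        once below n, is itself the required element of \<open>?D\<close>.\<close>
      have "x \<triangleright>\<^bsub>N\<^esub> f m \<sqsubseteq>\<^bsub>N\<^esub> n \<longleftrightarrow> (\<exists>d\<in>?D. x \<triangleright>\<^bsub>N\<^esub> f m \<sqsubseteq>\<^bsub>N\<^esub> d)" for x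
      proof
        assume "x \<triangleright>\<^bsub>N\<^esub> f m \<sqsubseteq>\<^bsub>N\<^esub> n"
        then have "x \<triangleright>\<^bsub>N\<^esub> f m \<in> ?D" using m by (auto simp: F(4)[symmetric])
        then show "\<exists>d\<in>?D. x \<triangleright>\<^bsub>N\<^esub> f m \<sqsubseteq>\<^bsub>N\<^esub> d" using m F(1) by (intro bexI) auto
      next
        assume "\<exists>d\<in>?D. x \<triangleright>\<^bsub>N\<^esub> f m \<sqsubseteq>\<^bsub>N\<^esub> d"
        then obtain d where d: "d \<in> ?D" "x \<triangleright>\<^bsub>N\<^esub> f m \<sqsubseteq>\<^bsub>N\<^esub> d" by blast
        show "x \<triangleright>\<^bsub>N\<^esub> f m \<sqsubseteq>\<^bsub>N\<^esub> n"
          by (rule N.le_trans[OF d(2)]) (use d(1) m nN F(1) in auto)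
      qed
      then have "x \<le> - g (f m) \<longleftrightarrow> x \<le> - g' (f m)" for x
        using g(2) g'(2) F(1)[OF m] by simp
      then have "- g (f m) = - g' (f m)" by (intro antisym) blast+
      then show ?thesis by simp
    qed
    have "g n = g' n"
      by (rule coker_pair_separates[OF N K f
            distributive_imp_heyting[OF distributive_module_lattice_mod] g(1) g'(1) agree n])
    \<comment> \<open>The greatest element of H acts as the identity, so this says that n lies below
      n. Carried over to \<open>g'\<close>, it puts n below some d in \<open>?D\<close>, and d is
      below n by the choice of \<open>?D\<close>.\<close>
    moreover have "Orderings.top \<le> - g n"
      using g(2)[OF nN, of Orderings.top] nN by (simp add: N.top_act)
    ultimately have "Orderings.top \<le> - g' n" by simp
    then obtain d where "d \<in> ?D" "n \<sqsubseteq>\<^bsub>N\<^esub> d"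
      using g'(2)[OF nN, of Orderings.top] nN by (auto simp: N.top_act)
    then have "d = n" using nN F(1) by (auto intro: N.le_antisym)
    then show ?thesis using \<open>d \<in> ?D\<close> by blast
  qed
  \<comment> \<open>The easy inclusion: \<open>k\<close> coequalizes the two inclusions after
    \<open>f\<close>.\<close>
  moreover have "k (incl1 N (f m)) = k (incl2 N (f m))" if "m \<in> carrier M" for m
    using is_coequalizerD(2)[OF K[unfolded is_coker_pair_def] that] by simp
  ultimately have "carrier (image_mod N k) = f ` carrier M"
    using F(1) by (auto simp: image_mod_def equalizer_def submod_def)
  \<comment> \<open>Both sides are restrictions of N, so equal carriers suffice.\<close>
  then show ?thesis
    by (simp add: range_mod_def image_mod_def equalizer_def submod_def)
qed

theorem proposition5p9:
  fixes M :: "('h :: {finite, boolean_algebra}, 'm) hmod"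
    and N :: "('h, 'n) hmod"
    and f :: "'m \<Rightarrow> 'n"
    and C :: "('h, 'm set) hmod" and c :: "'m \<Rightarrow> 'm set"
    and K :: "('h, ('n \<times> 'n) set) hmod" and k :: "'n \<times> 'n \<Rightarrow> ('n \<times> 'n) set"
  assumes "heyting_module M" and "heyting_module N" and "f \<in> mod_hom M N"
    and "is_coimage M f C c"
    and "is_coker_pair M N f K k"
  shows "(\<exists>\<phi>\<in>mod_iso C (range_mod M N f). \<forall>m\<in>carrier M. \<phi> (c m) = f m)
    \<and> range_mod M N f = image_mod N k"
  using coimage_iso_range[OF assms(1-4)] range_eq_image[OF assms(1-3,5)] by (rule conjI)

end
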